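(* For all integers $n\ge 1$, $\overline{SOME}(n)$ is even.
   Context: An overpartition of a nonnegative integer $n$ is a partition of $n$ in which the first occurrence of each distinct part may be overlined (or not). For $n\ge 0$, $\overline{SOME}(n)$ denotes the sum, over all overpartitions $\lambda$ of $n$, of (the sum of the odd parts of $\lambda$) minus (the sum of the even parts of $\lambda$), where parts are counted with multiplicity and an overlined part counts with its numerical size. *)

theory Defs
  imports Main
begin

text \<open>
  An overpartition is encoded as the weakly decreasing list of its parts, each paired with a
  flag that is \<^const>\<open>True\<close> iff that occurrence of the part is overlined. A flag may
  be set only if no earlier entry of the list has the same size.
\<close>

type_synonym overpartition = "(nat \<times> bool) list"

definition parts :: "overpartition \<Rightarrow> nat list" where
  "parts xs = map fst xs"

definition is_overpartition :: "nat \<Rightarrow> overpartition \<Rightarrow> bool" where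
  "is_overpartition n xs \<longleftrightarrow>
     (\<forall>p \<in> set (parts xs). p > 0) \<and>
     sorted_wrt (\<ge>) (parts xs) \<and>
     sum_list (parts xs) = n \<and>
     (\<forall>j < length xs. snd (xs ! j) \<longrightarrow> (\<forall>i < j. fst (xs ! i) \<noteq> fst (xs ! j)))"

definition overpartitions :: "nat \<Rightarrow> overpartition set" where
  "overpartitions n = {xs. is_overpartition n xs}"

definition odd_minus_even :: "overpartition \<Rightarrow> int" where
  "odd_minus_even xs =
     int (sum_list (filter odd (parts xs))) - int (sum_list (filter even (parts xs)))"

definition SOME_overline :: "nat \<Rightarrow> int" where
  "SOME_overline n = (\<Sum>xs \<in> overpartitions n. odd_minus_even xs)"

text \<open>The sum above ranges over a finite set.\<close>

lemma finite_overpartitions: "finite (overpartitions n)"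
proof (rule finite_subset)
  show "overpartitions n \<subseteq> {xs. set xs \<subseteq> {..n} \<times> UNIV \<and> length xs \<le> n}"
  proof
    fix xs assume "xs \<in> overpartitions n"
    then have pos: "\<forall>p \<in> set (parts xs). p > 0" and sum: "sum_list (parts xs) = n"
      by (auto simp: overpartitions_def is_overpartition_def)
    have "length ys \<le> sum_list ys" if "\<forall>p \<in> set ys. p > 0" for ys :: "nat list"
      using that by (induction ys) auto
    from this[OF pos] have "length xs \<le> n"
      using sum by (simp add: parts_def)
    moreover have "p \<le> n" if "p \<in> set (parts xs)" for p
      using member_le_sum_list[OF that] sum by simp
    ultimately show "xs \<in> {xs. set xs \<subseteq> {..n} \<times> UNIV \<and> length xs \<le> n}"
      by (force simp: parts_def)
  qed
  show "finite {xs :: overpartition. set xs \<subseteq> {..n} \<times> UNIV \<and> length xs \<le> n}"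
    by (rule finite_lists_length_le) simp
qed

end

theory Submission
  imports Defs
begin

text \<open>
  The largest part of a nonempty overpartition can always be switched between overlined and
  plain: its first occurrence opens the list, so nothing precedes it that could forbid the
  overline, and no other entry's condition refers to its flag. For \<open>n \<ge> 1\<close> this
  switch is an involution without fixed points on the overpartitions of \<open>n\<close>, and it leaves
  the sizes of the parts alone. Each value of \<^const>\<open>odd_minus_even\<close> is therefore
  contributed equally often with the first entry overlined as with it plain, and
  \<^const>\<open>SOME_overline\<close> is twice the sum over one of the two classes.
\<close>

fun toggle_first :: "overpartition \<Rightarrow> overpartition" where
  "toggle_first [] = []"
| "toggle_first ((p, b) # xs) = (p, \<not> b) # xs"

lemma toggle_first_involution: "toggle_first (toggle_first xs) = xs"
  by (cases xs rule: toggle_first.cases) auto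

lemma parts_toggle_first: "parts (toggle_first xs) = parts xs"
  by (cases xs rule: toggle_first.cases) (auto simp: parts_def)

lemma snd_hd_toggle_first:
  "xs \<noteq> [] \<Longrightarrow> snd (hd (toggle_first xs)) \<longleftrightarrow> \<not> snd (hd xs)"
  by (cases xs rule: toggle_first.cases) auto

text \<open>
  A flag is constrained only by the sizes of strictly earlier entries, so the flag in position
  0 is unconstrained and does not enter the condition on any other position.
\<close>

lemma is_overpartition_toggle_first:
  assumes "is_overpartition n xs"
  shows "is_overpartition n (toggle_first xs)"
proof (cases xs rule: toggle_first.cases)
  case 1
  with assms show ?thesis by simp
next
  case (2 p b ys)
  have len: "length (toggle_first xs) = length xs"
    using 2 by simp
  have size_eq: "fst (toggle_first xs ! i) = fst (xs ! i)" for i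
    using 2 by (cases i) auto
  have flag_eq: "snd (toggle_first xs ! j) = snd (xs ! j)" if "j > 0" for j
    using 2 that by (cases j) auto
  have "\<forall>i < j. fst (toggle_first xs ! i) \<noteq> fst (toggle_first xs ! j)"
    if "j < length (toggle_first xs)" "snd (toggle_first xs ! j)" for j
  proof (cases "j = 0")
    case False
    with that show ?thesis
      using assms flag_eq[of j] by (simp add: is_overpartition_def len size_eq)
  qed simp
  with assms show ?thesis
    by (simp add: is_overpartition_def parts_toggle_first)
qed

theorem corollary2:
  fixes n :: nat
  assumes "n \<ge> 1"
  shows "even (SOME_overline n)"
proof -
  define overlined where "overlined = {xs \<in> overpartitions n. snd (hd xs)}"
  define plain where "plain = {xs \<in> overpartitions n. \<not> snd (hd xs)}"
  have nonempty: "xs \<noteq> []" if "xs \<in> overpartitions n" for xs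
    using that assms by (auto simp: overpartitions_def is_overpartition_def parts_def)
  have closed: "toggle_first xs \<in> overpartitions n" if "xs \<in> overpartitions n" for xs
    using that by (simp add: overpartitions_def is_overpartition_toggle_first)
  have halves_agree: "sum odd_minus_even overlined = sum odd_minus_even plain"
    by (rule sum.reindex_bij_witness[where i = toggle_first and j = toggle_first])
      (auto simp: overlined_def plain_def toggle_first_involution closed nonempty
        snd_hd_toggle_first odd_minus_even_def parts_toggle_first)
  have "overpartitions n = overlined \<union> plain" "overlined \<inter> plain = {}"
    by (auto simp: overlined_def plain_def)
  moreover have "finite overlined" "finite plain"
    using finite_overpartitions[of n] by (auto simp: overlined_def plain_def)
  ultimately have "SOME_overline n = sum odd_minus_even overlined + sum odd_minus_even plain"
    by (simp add: SOME_overline_def sum.union_disjoint)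
  with halves_agree show ?thesis by simp
qed

end
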